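(* Let $\phi=(\phi_n)_{n\ge 1}$ be a sequence of non-negative integers. Then $\phi\in\mathcal{ER}$ if and only if for every $n\ge 1$ the integer $\sum_{d\mid n}\mu(n/d)\phi_d$ is non-negative and divisible by $n$.
   Context: For a map $T:X\to X$ on a set $X$ and $n\ge 1$, let $f_n(T)=\#\{x\in X\mid T^n x=x\}$ be the number of points with period $n$; all maps considered are assumed to have $f_n(T)$ finite for every $n\ge1$. A sequence $\phi=(\phi_n)_{n\ge1}$ of non-negative integers is exactly realizable, written $\phi\in\mathcal{ER}$, if there is a set $X$ and a map $T:X\to X$ with $f_n(T)=\phi_n$ for all $n\ge1$. Here $\mu$ is the Möbius function and $\sum_{d\mid n}$ runs over the positive divisors $d$ of $n$. *)

theory Defs
  imports "HOL-Computational_Algebra.Computational_Algebra"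
begin

text \<open>
  Sequences indexed by \<open>n \<ge> 1\<close> are functions on the natural numbers whose value at
  \<open>0\<close> is irrelevant. A map \<open>X \<rightarrow> X\<close> is a total function \<open>T\<close> with
  \<open>T ` X \<subseteq> X\<close>; its values outside \<open>X\<close> play no role.
\<close>

definition period_points :: "'a set \<Rightarrow> ('a \<Rightarrow> 'a) \<Rightarrow> nat \<Rightarrow> 'a set" where
  "period_points X T n = {x \<in> X. (T ^^ n) x = x}"

definition num_period :: "'a set \<Rightarrow> ('a \<Rightarrow> 'a) \<Rightarrow> nat \<Rightarrow> nat" where
  "num_period X T n = card (period_points X T n)"

text \<open>
  HOL cannot quantify over all sets of all types inside a formula, so the class of exactly
  realizable sequences takes as parameter the type whose subsets \<open>X\<close> range over; the type must be
  infinite to contain enough points, and any map on a subset of a finite type can be copied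
  injectively into an infinite one. The finiteness
  requirement is explicit because \<open>card\<close> is \<open>0\<close> on infinite sets.
\<close>

definition exactly_realizable :: "'a itself \<Rightarrow> (nat \<Rightarrow> nat) set" ("\<E>\<R>'(_')") where
  "exactly_realizable (_ :: 'a itself) =
     {\<phi>. \<exists>(X :: 'a set) T. T ` X \<subseteq> X \<and>
            (\<forall>n\<ge>1. finite (period_points X T n)) \<and>
            (\<forall>n\<ge>1. num_period X T n = \<phi> n)}"

definition moebius_mu :: "nat \<Rightarrow> int" ("\<mu>") where
  "\<mu> n = (if squarefree n then (-1) ^ card (prime_factors n) else 0)"

end

theory Submission
  imports Defs "HOL-Library.Countable"
begin

text \<open>
  For \<open>n \<ge> 1\<close>, a point fixed by \<open>T ^^ n\<close> has a least period, and that period divides \<open>n\<close>.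
  So if \<open>l d\<close> denotes the number of points of least period \<open>d\<close>, the periodic point counts are
  \<open>\<phi> n = (\<Sum>d | d dvd n. l d)\<close>, and Moebius inversion says that the sum in the
  criterion is exactly \<open>l n\<close>. It is therefore non-negative, and it is divisible by \<open>n\<close> because the points
  of least period \<open>n\<close> fall into orbits of exactly \<open>n\<close> points each
  (lemma \<open>dvd_card_least_period_points\<close>).

  Conversely, when the criterion holds, the sum divided by \<open>n\<close> is a natural number \<open>c n\<close>, and it prescribes
  how many orbits of length \<open>n\<close> a map should have. The disjoint union of \<open>c n\<close> cycles
  of length \<open>n\<close>, over all \<open>n\<close>, has \<open>\<Sum>d | d dvd n. c d * d\<close> points of period \<open>n\<close>, and
  inversion in the other direction identifies this number with \<open>\<phi> n\<close>. The union is countable, so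
  it can be copied into any infinite type (lemma \<open>exactly_realizable_cycles\<close>).
\<close>

section \<open>Moebius inversion\<close>

text \<open>
  The squarefree divisors of \<open>n\<close> are the products of the sets of prime divisors of \<open>n\<close>, so the sum
  is the expansion of the product of \<open>-1 + 1\<close> over the prime divisors, which is empty
  only for \<open>n = 1\<close>.
\<close>
lemma sum_moebius_mu_dvd:
  assumes "n \<ge> 1"
  shows "(\<Sum>d | d dvd n. \<mu> d) = (if n = 1 then 1 else 0)"
proof -
  let ?P = "prime_factors n"
  have fin: "finite {d. d dvd n}"
    using assms by (intro finite_divisors_nat) auto
  have pf: "prime_factors (\<Prod>S) = S" "squarefree (\<Prod>S)" "\<Prod>S dvd n" "\<Prod>S \<noteq> 0" if "S \<subseteq> ?P" for S
  proof -
    have pr: "prime p" if "p \<in> S" for p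
      using that \<open>S \<subseteq> ?P\<close> by auto
    have S: "finite S" using that finite_subset by blast
    have pz: "prime_factorization (\<Prod>S) = mset_set S"
      using prime_factorization_prod_mset_primes[of "mset_set S"] pr S
      by (simp add: prod_unfold_prod_mset)
    show nz: "\<Prod>S \<noteq> 0"
      using S pr[of 0] by auto
    show "prime_factors (\<Prod>S) = S"
      using pz S by simp
    show "squarefree (\<Prod>S)"
      by (rule squarefree_prod_coprime) (simp_all add: pr primes_coprime squarefree_prime)
    have "mset_set S \<subseteq># prime_factorization n"
      using that S mset_set_set_mset_msubset[of "prime_factorization n"]
        subset_imp_msubset_mset_set[of S ?P] by (meson finite_set_mset subset_mset.order_trans)
    then show "\<Prod>S dvd n"
      using nz assms prime_factorization_subset_iff_dvd[of "\<Prod>S" n] by (simp add: pz)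
  qed
  have "(\<Sum>d | d dvd n. \<mu> d) = (\<Sum>d | d dvd n \<and> squarefree d. (-1) ^ card (prime_factors d))"
    using fin by (intro sum.mono_neutral_cong_right) (auto simp: moebius_mu_def)
  also have "\<dots> = (\<Sum>S\<in>Pow ?P. (-1) ^ card S)"
  proof (rule sum.reindex_bij_witness[of _ "\<lambda>S. \<Prod>S" prime_factors])
    fix d assume "d \<in> {d. d dvd n \<and> squarefree d}"
    then have d: "d dvd n" "squarefree d" by auto
    then have "d > 0" using assms dvd_pos_nat[of n d] by simp
    then have "d = (\<Prod>p\<in>prime_factors d. p ^ multiplicity p d)"
      by (rule prime_factorization_nat)
    also have "\<dots> = \<Prod>(prime_factors d)"
      using d \<open>d > 0\<close> by (intro prod.cong) (simp_all add: squarefree_factorial_semiring')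
    finally show "\<Prod>(prime_factors d) = d" by simp
    show "prime_factors d \<in> Pow ?P"
      using d assms by (auto dest: dvd_prime_factors[rotated])
  qed (use pf in auto)
  also have "\<dots> = (\<Prod>p\<in>?P. (-1) + 1)"
    by (subst prod_add) auto
  also have "\<dots> = (if n = 1 then 1 else 0)"
    using assms by (auto simp: prime_factorization_empty_iff card_eq_0_iff power_0_left)
  finally show ?thesis .
qed

lemma sum_divisors_reverse:
  fixes f :: "nat \<Rightarrow> 'b::comm_monoid_add"
  assumes "n \<ge> 1"
  shows "(\<Sum>d | d dvd n. f (n div d)) = (\<Sum>d | d dvd n. f d)"
  using assms
  by (intro sum.reindex_bij_witness[of _ "\<lambda>d. n div d" "\<lambda>d. n div d"]) (auto elim!: dvdE)

text \<open>
  Exchanging the order of summation over the chains \<open>e dvd d dvd n\<close>, with \<open>d = e * k\<close>, leaves for each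
  \<open>e\<close> a sum over the divisors of \<open>n div e\<close>. In both directions of Moebius inversion that inner
  sum becomes \<open>\<Sum>k | k dvd n div e. \<mu> k\<close>.
\<close>
lemma sum_divisors_of_divisors:
  fixes F :: "nat \<Rightarrow> nat \<Rightarrow> 'b::comm_monoid_add"
  assumes "n \<ge> 1"
  shows "(\<Sum>d | d dvd n. \<Sum>e | e dvd d. F d e) = (\<Sum>e | e dvd n. \<Sum>k | k dvd n div e. F (e * k) e)"
proof -
  have fin: "finite {d. d dvd m}" if "m dvd n" for m
    using dvd_pos_nat[OF _ that] assms by (intro finite_divisors_nat) simp
  have fin': "finite {k. k dvd n div e}" if "e dvd n" for e
    using that by (intro fin) auto
  have "(\<Sum>d | d dvd n. \<Sum>e | e dvd d. F d e) = (\<Sum>(d, e)\<in>(SIGMA d:{d. d dvd n}. {e. e dvd d}). F d e)"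
    using fin by (intro sum.Sigma) auto
  also have "\<dots> = (\<Sum>(e, k)\<in>(SIGMA e:{e. e dvd n}. {k. k dvd n div e}). F (e * k) e)"
    using assms
    by (intro sum.reindex_bij_witness[of _ "\<lambda>(e, k). (e * k, e)" "\<lambda>(d, e). (e, d div e)"])
      (auto elim!: dvdE)
  also have "\<dots> = (\<Sum>e | e dvd n. \<Sum>k | k dvd n div e. F (e * k) e)"
    using fin by (intro sum.Sigma[symmetric]) (simp_all add: fin fin')
  finally show ?thesis .
qed

lemma sum_divisors_delta:
  fixes b :: "nat \<Rightarrow> int"
  assumes "n \<ge> 1"
  shows "(\<Sum>e | e dvd n. b e * (\<Sum>k | k dvd n div e. \<mu> k)) = b n"
proof -
  have "(\<Sum>e | e dvd n. b e * (\<Sum>k | k dvd n div e. \<mu> k)) = (\<Sum>e | e dvd n. if e = n then b e else 0)"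
  proof (rule sum.cong)
    fix e assume "e \<in> {e. e dvd n}"
    then show "b e * (\<Sum>k | k dvd n div e. \<mu> k) = (if e = n then b e else 0)"
      using assms by (subst sum_moebius_mu_dvd) (auto elim!: dvdE)
  qed simp
  also have "\<dots> = b n"
    using assms finite_divisors_nat[of n] by (subst sum.delta) auto
  finally show ?thesis .
qed

lemma moebius_inversion:
  fixes b :: "nat \<Rightarrow> int"
  assumes "n \<ge> 1"
  shows "(\<Sum>d | d dvd n. \<mu> (n div d) * (\<Sum>e | e dvd d. b e)) = b n"
proof -
  have "(\<Sum>d | d dvd n. \<mu> (n div d) * (\<Sum>e | e dvd d. b e)) =
      (\<Sum>e | e dvd n. b e * (\<Sum>k | k dvd n div e. \<mu> (n div e div k)))"
    using assms
    by (simp add: sum_distrib_left sum_divisors_of_divisors mult.commute div_mult2_eq)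
  also have "\<dots> = (\<Sum>e | e dvd n. b e * (\<Sum>k | k dvd n div e. \<mu> k))"
    using assms by (intro sum.cong refl arg_cong2[where f = "(*)"] sum_divisors_reverse) (auto elim!: dvdE)
  finally show ?thesis
    using assms by (simp add: sum_divisors_delta)
qed

text \<open>
  This is the other direction of the inversion: summing the Moebius transform over divisors recovers
  the sequence.
\<close>
lemma sum_divisors_moebius_transform:
  fixes a :: "nat \<Rightarrow> int"
  assumes "n \<ge> 1"
  shows "(\<Sum>d | d dvd n. \<Sum>e | e dvd d. \<mu> (d div e) * a e) = a n"
proof -
  have "(\<Sum>d | d dvd n. \<Sum>e | e dvd d. \<mu> (d div e) * a e) =
      (\<Sum>e | e dvd n. a e * (\<Sum>k | k dvd n div e. \<mu> k))"
    unfolding sum_divisors_of_divisors[OF assms] sum_distrib_left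
  proof (intro sum.cong refl)
    fix e k assume "e \<in> {e. e dvd n}"
    then have "e > 0" using assms dvd_pos_nat[of n e] by simp
    then show "\<mu> (e * k div e) * a e = a e * \<mu> k" by simp
  qed
  then show ?thesis
    using assms by (simp add: sum_divisors_delta)
qed

section \<open>Points of given least period\<close>

text \<open>
  Requiring that the return times are the multiples of \<open>d\<close> makes \<open>d\<close> the least period when
  \<open>d \<ge> 1\<close>; for \<open>d = 0\<close> it singles out the points that are not periodic.
\<close>
definition least_period_points :: "'a set \<Rightarrow> ('a \<Rightarrow> 'a) \<Rightarrow> nat \<Rightarrow> 'a set" where
  "least_period_points X T d = {x \<in> X. \<forall>k. (T ^^ k) x = x \<longleftrightarrow> d dvd k}"

lemma funpow_fixed_iff_least_period_dvd:
  "x \<in> least_period_points X T d \<Longrightarrow> (T ^^ k) x = x \<longleftrightarrow> d dvd k"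
  unfolding least_period_points_def by blast

text \<open>
  The least return time \<open>d\<close> divides every return time \<open>k\<close>, since \<open>k mod d\<close> is again a return time and
  is smaller than \<open>d\<close>.
\<close>
lemma period_points_eq_Union_least_period_points:
  assumes "n \<ge> 1"
  shows "period_points X T n = (\<Union>d\<in>{d. d dvd n}. least_period_points X T d)"
proof (intro equalityI subsetI)
  fix x assume "x \<in> period_points X T n"
  then have x: "x \<in> X" "(T ^^ n) x = x" by (auto simp: period_points_def)
  define d where "d = (LEAST d. d \<ge> 1 \<and> (T ^^ d) x = x)"
  have d: "d \<ge> 1" "(T ^^ d) x = x"
    using LeastI[of "\<lambda>d. d \<ge> 1 \<and> (T ^^ d) x = x" n] x assms by (auto simp: d_def)
  have "(T ^^ k) x = x \<longleftrightarrow> d dvd k" for k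
  proof
    assume "(T ^^ k) x = x"
    then have "(T ^^ (k mod d)) x = x"
      using funpow_mod_eq[OF d(2), of k] by simp
    moreover have "k mod d < d" using d by simp
    ultimately have "k mod d = 0"
      using not_less_Least[of "k mod d" "\<lambda>d. d \<ge> 1 \<and> (T ^^ d) x = x"] by (auto simp: d_def)
    then show "d dvd k" by auto
  next
    assume "d dvd k"
    then show "(T ^^ k) x = x"
      using funpow_mod_eq[OF d(2), of k] by simp
  qed
  with x show "x \<in> (\<Union>d\<in>{d. d dvd n}. least_period_points X T d)"
    unfolding least_period_points_def by blast
next
  fix x assume "x \<in> (\<Union>d\<in>{d. d dvd n}. least_period_points X T d)"
  then obtain d where "d dvd n" "x \<in> least_period_points X T d" by blast
  then show "x \<in> period_points X T n"
    using funpow_fixed_iff_least_period_dvd[of x X T d n]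
    by (simp add: period_points_def least_period_points_def)
qed

lemma least_period_points_disjoint:
  assumes "d \<noteq> e"
  shows "least_period_points X T d \<inter> least_period_points X T e = {}"
proof (rule ccontr)
  assume "least_period_points X T d \<inter> least_period_points X T e \<noteq> {}"
  then obtain x where "x \<in> least_period_points X T d" "x \<in> least_period_points X T e" by blast
  then have "d dvd k \<longleftrightarrow> e dvd k" for k
    by (simp flip: funpow_fixed_iff_least_period_dvd)
  then have "d = e"
    by (metis dvd_antisym dvd_refl)
  with assms show False by contradiction
qed

lemma funpow_eq_iff_least_period:
  assumes "x \<in> least_period_points X T d" and "d \<ge> 1"
  shows "(T ^^ i) x = (T ^^ j) x \<longleftrightarrow> i mod d = j mod d"
proof -
  have per: "(T ^^ k) x = x \<longleftrightarrow> d dvd k" for k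
    using assms(1) by (rule funpow_fixed_iff_least_period_dvd)
  have md: "(T ^^ (k mod d)) x = (T ^^ k) x" for k
    by (rule funpow_mod_eq) (simp add: per)
  \<comment> \<open>Applying \<open>T\<close> another \<open>d - i\<close> times brings the left side back to \<open>x\<close>, so \<open>d + (j - i)\<close> is a return time.\<close>
  have *: "d dvd j - i" if "(T ^^ i) x = (T ^^ j) x" "i \<le> j" "i \<le> d" for i j
  proof -
    have "x = (T ^^ (d - i + i)) x" using per[of d] that by (metis dvd_refl le_add_diff_inverse2)
    also have "\<dots> = (T ^^ (d - i)) ((T ^^ j) x)" using that by (simp only: funpow_add o_apply)
    also have "\<dots> = (T ^^ (d - i + j)) x" by (simp add: funpow_add)
    also have "d - i + j = d + (j - i)" using that by simp
    finally have "d dvd d + (j - i)" by (metis per)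
    then show ?thesis by simp
  qed
  have le: "i mod d = j mod d" if "(T ^^ i) x = (T ^^ j) x" "i mod d \<le> j mod d" for i j
  proof -
    \<comment> \<open>The difference of the two residues is a multiple of \<open>d\<close> smaller than \<open>d\<close>, hence zero.\<close>
    have "d dvd j mod d - i mod d"
      using that assms by (intro *) (auto simp: md intro: less_imp_le)
    moreover have "j mod d - i mod d < d"
      using assms by (metis less_imp_diff_less mod_less_divisor less_le_trans zero_less_one)
    ultimately show ?thesis using that by (auto dest: nat_dvd_not_less)
  qed
  show ?thesis
    using le[of i j] le[of j i] md by (metis nat_le_linear)
qed

text \<open>
  Lying on the same orbit is an equivalence relation on these points, and each class
  consists of the \<open>d\<close> distinct points \<open>x\<close>, \<open>T x\<close>, ..., \<open>(T ^^ (d - 1)) x\<close>.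
\<close>
lemma dvd_card_least_period_points:
  assumes T: "T ` X \<subseteq> X" and d: "d \<ge> 1" and fin: "finite (least_period_points X T d)"
  shows "d dvd card (least_period_points X T d)"
proof -
  let ?P = "least_period_points X T d"
  define r where "r = {(x, y). x \<in> ?P \<and> y \<in> ?P \<and> (\<exists>k. y = (T ^^ k) x)}"
  have per: "(T ^^ k) x = x \<longleftrightarrow> d dvd k" if "x \<in> ?P" for x k
    using that by (rule funpow_fixed_iff_least_period_dvd)
  have closed: "(T ^^ k) x \<in> ?P" if "x \<in> ?P" for x k
  proof -
    have "(T ^^ k) x \<in> X"
    proof (induction k)
      case 0
      show ?case using that by (simp add: least_period_points_def)
    next
      case (Suc k)
      then show ?case using T by auto
    qed
    moreover have "(T ^^ l) ((T ^^ k) x) = (T ^^ k) x \<longleftrightarrow> d dvd l" for l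
    proof -
      have "(T ^^ l) ((T ^^ k) x) = (T ^^ k) x \<longleftrightarrow> (T ^^ (l + k)) x = (T ^^ k) x"
        by (simp add: funpow_add)
      also have "\<dots> \<longleftrightarrow> (l + k) mod d = k mod d"
        by (rule funpow_eq_iff_least_period[OF that d])
      also have "\<dots> \<longleftrightarrow> d dvd l"
        using mod_eq_dvd_iff_nat[of k "l + k" d] by simp
      finally show ?thesis .
    qed
    ultimately show ?thesis by (simp add: least_period_points_def)
  qed
  have eq: "equiv ?P r"
  proof (rule equivI)
    show "refl_on ?P r"
      by (auto simp: r_def refl_on_def intro: exI[of _ 0])
    show "sym r"
    proof (rule symI)
      fix x y assume "(x, y) \<in> r"
      then obtain k where k: "x \<in> ?P" "y \<in> ?P" "y = (T ^^ k) x" by (auto simp: r_def)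
      \<comment> \<open>After the \<open>k\<close> steps from \<open>x\<close> to \<open>y\<close>, the orbit returns to \<open>x\<close> once \<open>k * d\<close> steps are completed.\<close>
      have "(T ^^ (k * d - k)) y = (T ^^ (k * d - k + k)) x"
        by (simp add: k funpow_add)
      also have "k * d - k + k = k * d" using d by (intro le_add_diff_inverse2) auto
      also have "(T ^^ (k * d)) x = x" using per[OF k(1)] by simp
      finally have "x = (T ^^ (k * d - k)) y" by simp
      with k(1,2) show "(y, x) \<in> r" unfolding r_def by blast
    qed
    show "trans r"
      by (rule transI) (auto simp: r_def, metis funpow_add o_apply)
  qed (auto simp: r_def)
  show ?thesis
  proof (rule equiv_imp_dvd_card[OF fin eq])
    fix C assume "C \<in> ?P // r"
    then obtain x where x: "x \<in> ?P" "C = r `` {x}" by (auto elim: quotientE)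
    have "C = (\<lambda>k. (T ^^ k) x) ` {..<d}"
    proof (intro equalityI subsetI)
      fix y assume "y \<in> C"
      then obtain k where "y = (T ^^ k) x" using x by (auto simp: r_def)
      also have "\<dots> = (T ^^ (k mod d)) x"
        by (rule funpow_mod_eq[symmetric]) (simp add: per x)
      finally show "y \<in> (\<lambda>k. (T ^^ k) x) ` {..<d}" using d by auto
    qed (use x closed in \<open>auto simp: r_def\<close>)
    moreover have "inj_on (\<lambda>k. (T ^^ k) x) {..<d}"
      by (rule inj_onI) (simp add: funpow_eq_iff_least_period[OF x(1) d])
    ultimately show "d dvd card C" by (simp add: card_image)
  qed
qed

lemma num_period_eq_sum_least_period:
  assumes "n \<ge> 1" and "finite (period_points X T n)"
  shows "num_period X T n = (\<Sum>d | d dvd n. card (least_period_points X T d))"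
  unfolding num_period_def period_points_eq_Union_least_period_points[OF assms(1)]
proof (rule card_UN_disjoint)
  show "finite {d. d dvd n}"
    using assms(1) by (intro finite_divisors_nat) simp
  show "\<forall>d\<in>{d. d dvd n}. finite (least_period_points X T d)"
    using assms by (simp add: period_points_eq_Union_least_period_points)
qed (simp add: least_period_points_disjoint)

section \<open>Realization by disjoint cycles\<close>

text \<open>The triple \<open>(n, j, i)\<close> is position \<open>i\<close> on the \<open>j\<close>-th of the \<open>c n\<close> cycles of length \<open>n\<close>.\<close>
definition cycles :: "(nat \<Rightarrow> nat) \<Rightarrow> (nat \<times> nat \<times> nat) set" where
  "cycles c = {(n, j, i). j < c n \<and> i < n}"

definition rotate_cycles :: "nat \<times> nat \<times> nat \<Rightarrow> nat \<times> nat \<times> nat" where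
  "rotate_cycles = (\<lambda>(n, j, i). (n, j, Suc i mod n))"

lemma funpow_rotate_cycles:
  "i < n \<Longrightarrow> (rotate_cycles ^^ k) (n, j, i) = (n, j, (i + k) mod n)"
  by (induction k) (auto simp: rotate_cycles_def mod_Suc_eq)

lemma rotate_cycles_closed: "rotate_cycles ` cycles c \<subseteq> cycles c"
  by (auto simp: cycles_def rotate_cycles_def)

lemma period_points_cycles:
  "period_points (cycles c) rotate_cycles k = (SIGMA n:{n. n dvd k}. {..<c n} \<times> {..<n})"
proof -
  have "(i + k) mod n = i \<longleftrightarrow> n dvd k" if "i < n" for i n
    using mod_eq_dvd_iff_nat[of i "i + k" n] that by simp
  then show ?thesis
    by (auto simp: period_points_def cycles_def funpow_rotate_cycles)
qed

lemma period_points_conjugate: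
  assumes "inj f"
  shows "period_points (f ` Y) (f \<circ> S \<circ> inv f) n = f ` period_points Y S n"
proof -
  have "((f \<circ> S \<circ> inv f) ^^ n) (f y) = f ((S ^^ n) y)" for y
    using assms by (induction n) auto
  then show ?thesis
    using assms by (auto simp: period_points_def inj_eq)
qed

text \<open>
  The values \<open>c n\<close> are the numbers of orbits of length \<open>n\<close>. Infinitude of the target type serves to embed
  the countable system of cycles; conjugating by the embedding keeps the periodic point counts.
\<close>
lemma exactly_realizable_cycles:
  fixes \<phi> :: "nat \<Rightarrow> nat"
  assumes "infinite (UNIV :: 'a set)"
    and \<phi>: "\<And>n. n \<ge> 1 \<Longrightarrow> \<phi> n = (\<Sum>d | d dvd n. c d * d)"
  shows "\<phi> \<in> \<E>\<R>(TYPE('a))"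
proof -
  obtain g :: "nat \<Rightarrow> 'a" where g: "inj g"
    using assms(1) infinite_countable_subset by blast
  define f :: "nat \<times> nat \<times> nat \<Rightarrow> 'a" where "f = g \<circ> to_nat"
  have f: "inj f" unfolding f_def by (intro inj_compose g inj_to_nat)
  let ?X = "f ` cycles c" and ?T = "f \<circ> rotate_cycles \<circ> inv f"
  have P: "period_points ?X ?T n = f ` (SIGMA d:{d. d dvd n}. {..<c d} \<times> {..<d})" for n
    by (simp add: period_points_conjugate f period_points_cycles)
  have "?T ` ?X \<subseteq> ?X"
    using f rotate_cycles_closed[of c] by auto
  moreover have "finite (period_points ?X ?T n)" if "n \<ge> 1" for n
    using that finite_divisors_nat[of n] by (auto simp: P)
  moreover have "num_period ?X ?T n = \<phi> n" if "n \<ge> 1" for n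
    using that finite_divisors_nat[of n] f unfolding num_period_def P
    by (subst card_image) (auto simp: \<phi> intro: inj_on_subset)
  ultimately show ?thesis
    unfolding exactly_realizable_def by blast
qed

theorem lemma2p1:
  fixes \<phi> :: "nat \<Rightarrow> nat"
  assumes "infinite (UNIV :: 'a set)"
  shows "\<phi> \<in> \<E>\<R>(TYPE('a)) \<longleftrightarrow>
    (\<forall>n\<ge>1. (\<Sum>d | d dvd n. \<mu> (n div d) * int (\<phi> d)) \<ge> 0 \<and>
            int n dvd (\<Sum>d | d dvd n. \<mu> (n div d) * int (\<phi> d)))"
proof -
  define b where "b n = (\<Sum>d | d dvd n. \<mu> (n div d) * int (\<phi> d))" for n
  have "\<phi> \<in> \<E>\<R>(TYPE('a)) \<longleftrightarrow> (\<forall>n\<ge>1. b n \<ge> 0 \<and> int n dvd b n)"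
  proof
    assume "\<phi> \<in> \<E>\<R>(TYPE('a))"
    then obtain X :: "'a set" and T where T: "T ` X \<subseteq> X"
      and fin: "\<And>n. n \<ge> 1 \<Longrightarrow> finite (period_points X T n)"
      and num: "\<And>n. n \<ge> 1 \<Longrightarrow> num_period X T n = \<phi> n"
      unfolding exactly_realizable_def by blast
    show "\<forall>n\<ge>1. b n \<ge> 0 \<and> int n dvd b n"
    proof (intro allI impI)
      fix n :: nat assume n: "n \<ge> 1"
      have "b n = (\<Sum>d | d dvd n. \<mu> (n div d) * (\<Sum>e | e dvd d. int (card (least_period_points X T e))))"
        unfolding b_def
      proof (intro sum.cong refl)
        fix d assume "d \<in> {d. d dvd n}"
        then have "d \<ge> 1" using n dvd_pos_nat[of n d] by simp
        then show "\<mu> (n div d) * int (\<phi> d) =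
            \<mu> (n div d) * (\<Sum>e | e dvd d. int (card (least_period_points X T e)))"
          by (simp add: num[symmetric] num_period_eq_sum_least_period fin)
      qed
      also have "\<dots> = int (card (least_period_points X T n))"
        using n by (rule moebius_inversion)
      finally have "b n = int (card (least_period_points X T n))" .
      moreover have "finite (least_period_points X T n)"
        using fin[OF n] unfolding period_points_eq_Union_least_period_points[OF n]
        by (rule rev_finite_subset) (simp add: UN_upper)
      ultimately show "b n \<ge> 0 \<and> int n dvd b n"
        using dvd_card_least_period_points[OF T n] by simp
    qed
  next
    assume b: "\<forall>n\<ge>1. b n \<ge> 0 \<and> int n dvd b n"
    define c where "c n = nat (b n) div n" for n
    have "\<phi> n = (\<Sum>d | d dvd n. c d * d)" if n: "n \<ge> 1" for n
    proof -
      have "int (\<phi> n) = (\<Sum>d | d dvd n. b d)"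
        using sum_divisors_moebius_transform[OF n, of "\<lambda>d. int (\<phi> d)"] by (simp only: b_def)
      also have "\<dots> = (\<Sum>d | d dvd n. int (c d * d))"
      proof (intro sum.cong refl)
        fix d assume "d \<in> {d. d dvd n}"
        then have "d \<ge> 1" using n dvd_pos_nat[of n d] by simp
        then have "b d \<ge> 0" "d dvd nat (b d)" using b by (simp_all flip: int_dvd_int_iff)
        then show "b d = int (c d * d)"
          by (metis c_def dvd_div_mult_self int_nat_eq)
      qed
      also have "\<dots> = int (\<Sum>d | d dvd n. c d * d)" by simp
      finally show ?thesis by (simp only: of_nat_eq_iff)
    qed
    then show "\<phi> \<in> \<E>\<R>(TYPE('a))"
      by (rule exactly_realizable_cycles[OF assms])
  qed
  then show ?thesis by (simp add: b_def)
qed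

end
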